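(* Let $D$ be a biorientation of a complete split graph. If $D$ has a sink, then there is a unique minimum-size quasi-kernel of $D$, and it is the set of all sinks of $D$. If $D$ is sink-free, then the minimal size of a quasi-kernel of $D$ is at most two.
   Context: All graphs and digraphs are finite and loopless. A complete split graph is an undirected graph whose vertex set can be partitioned into a clique (the clique-part) and an independent set (the independent-part) such that every vertex of the independent-part is adjacent to every vertex of the clique-part. A biorientation of an undirected graph is a digraph obtained by replacing each edge $uv$ by the single arc $(u,v)$, or the single arc $(v,u)$, or both arcs $(u,v)$ and $(v,u)$. A sink is a vertex with no outneighbor; a digraph is sink-free if it has no sink. A quasi-kernel of a digraph $D$ is an independent set $Q\subseteq V(D)$ (no arc between any two vertices of $Q$) such that from every vertex of $D$ there is a directed path of length at most two to some vertex of $Q$ (length zero for vertices of $Q$). *)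

theory Defs
  imports "Graph_Theory.Arc_Walk"
begin

text \<open>
  As in Graph\_Theory, undirected graphs are symmetric digraphs: the locale \<open>graph\<close> (finite,
  loopless, no parallel edges), where \<open>u \<rightarrow>\<^bsub>G\<^esub> v\<close> says that \<open>uv\<close> is an edge. The locale \<open>digraph\<close>
  excludes loops and parallel arcs, but allows pairs of opposite arcs.
\<close>

definition clique_in :: "('a,'b) pre_digraph \<Rightarrow> 'a set \<Rightarrow> bool" where
  "clique_in G K \<longleftrightarrow> K \<subseteq> verts G \<and> (\<forall>u\<in>K. \<forall>v\<in>K. u \<noteq> v \<longrightarrow> u \<rightarrow>\<^bsub>G\<^esub> v)"

definition independent_in :: "('a,'b) pre_digraph \<Rightarrow> 'a set \<Rightarrow> bool" where
  "independent_in G S \<longleftrightarrow> S \<subseteq> verts G \<and> (\<forall>u\<in>S. \<forall>v\<in>S. \<not> u \<rightarrow>\<^bsub>G\<^esub> v)"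

text \<open>Either part may be empty, so complete graphs and edgeless graphs are included.\<close>

definition complete_split_graph :: "('a,'b) pre_digraph \<Rightarrow> bool" where
  "complete_split_graph G \<longleftrightarrow> graph G \<and>
    (\<exists>K I. verts G = K \<union> I \<and> K \<inter> I = {} \<and> clique_in G K \<and> independent_in G I \<and>
      (\<forall>v\<in>I. \<forall>u\<in>K. v \<rightarrow>\<^bsub>G\<^esub> u))"

text \<open>
  The arc types of \<open>D\<close> and \<open>G\<close> may differ; only adjacency matters, since neither has parallel arcs.
\<close>

definition biorientation :: "('a,'b) pre_digraph \<Rightarrow> ('a,'c) pre_digraph \<Rightarrow> bool" where
  "biorientation D G \<longleftrightarrow> digraph D \<and> graph G \<and> verts D = verts G \<and>
    (\<forall>u v. u \<rightarrow>\<^bsub>G\<^esub> v \<longleftrightarrow> u \<rightarrow>\<^bsub>D\<^esub> v \<or> v \<rightarrow>\<^bsub>D\<^esub> u)"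

definition sinks :: "('a,'b) pre_digraph \<Rightarrow> 'a set" where
  "sinks D = {v \<in> verts D. \<not> (\<exists>w. v \<rightarrow>\<^bsub>D\<^esub> w)}"

definition sink_free :: "('a,'b) pre_digraph \<Rightarrow> bool" where
  "sink_free D \<longleftrightarrow> sinks D = {}"

definition quasi_kernel :: "('a,'b) pre_digraph \<Rightarrow> 'a set \<Rightarrow> bool" where
  "quasi_kernel D Q \<longleftrightarrow> independent_in D Q \<and>
    (\<forall>v\<in>verts D. \<exists>q\<in>Q. \<exists>p. pre_digraph.apath D v p q \<and> length p \<le> 2)"

definition minimum_quasi_kernel :: "('a,'b) pre_digraph \<Rightarrow> 'a set \<Rightarrow> bool" where
  "minimum_quasi_kernel D Q \<longleftrightarrow>
    quasi_kernel D Q \<and> (\<forall>Q'. quasi_kernel D Q' \<longrightarrow> card Q \<le> card Q')"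

end

theory Submission
  imports Defs
begin

text \<open>
  A quasi-kernel contains every sink, so in the presence of sinks it suffices that the sinks form a
  quasi-kernel. Suppose \<open>D\<close> is sink-free with clique-part \<open>K\<close> and independent-part \<open>I\<close>, and let \<open>v\<close>
  have maximum indegree in \<open>D[K]\<close>, so that all of \<open>K\<close> reaches \<open>v\<close> in two steps inside \<open>K\<close>. If \<open>{v}\<close>
  fails, choose \<open>u \<in> I\<close>, among the vertices not reaching \<open>v\<close> in two steps, with the fewest
  outneighbours, and let \<open>A\<close> be its set of outneighbours. Both \<open>v\<close> and its inneighbours in \<open>K\<close> lie
  outside \<open>A\<close>, hence dominate \<open>u\<close>; so \<open>u\<close> is reached from everything except possibly vertices of \<open>I\<close>
  with outneighbourhood exactly \<open>A\<close>. If some vertex of \<open>A\<close> dominates some \<open>j \<in> I\<close>, then \<open>{u, j}\<close> is a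
  quasi-kernel. Otherwise \<open>I\<close> dominates \<open>A\<close>, and a vertex of maximum indegree in \<open>D[A]\<close> is a
  quasi-kernel, since \<open>K - A\<close> dominates \<open>u\<close>, which dominates \<open>A\<close>.
\<close>

text \<open>Stated for a bare relation, so that the combinatorics needs neither arcs nor paths;
  \<open>apath_le_2_iff_reach2\<close> makes the connection.\<close>

definition reach2 :: "('a \<Rightarrow> 'a \<Rightarrow> bool) \<Rightarrow> 'a \<Rightarrow> 'a \<Rightarrow> bool" where
  "reach2 R u v \<longleftrightarrow> u = v \<or> R u v \<or> (\<exists>w. R u w \<and> R w v)"

lemma reach2_refl [simp]: "reach2 R u u"
  by (simp add: reach2_def)

lemma reach2_step: "R u v \<Longrightarrow> reach2 R u v"
  by (simp add: reach2_def)

lemma reach2_two_steps: "R u w \<Longrightarrow> R w v \<Longrightarrow> reach2 R u v"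
  by (auto simp: reach2_def)

text \<open>If \<open>u\<close> did not reach a vertex \<open>v\<close> of maximum indegree, then
  \<open>v\<close> and all its inneighbours would dominate \<open>u\<close>, giving \<open>u\<close>
  a larger indegree. The middle vertex \<open>w\<close> is recorded as lying in \<open>A\<close>
  because \<open>reach2_dominating_set\<close> uses that it belongs to the clique-part.\<close>

lemma semicomplete_reach2:
  assumes "finite A" "A \<noteq> {}"
    and semi: "\<And>x y. x \<in> A \<Longrightarrow> y \<in> A \<Longrightarrow> x \<noteq> y \<Longrightarrow> R x y \<or> R y x"
  shows "\<exists>v\<in>A. \<forall>u\<in>A. u = v \<or> R u v \<or> (\<exists>w\<in>A. R u w \<and> R w v)"
proof -
  \<comment> \<open>\<open>R\<close> may have loops; requiring \<open>u \<noteq> v\<close> keeps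
    \<open>v\<close> out of \<open>?N v\<close>, so that inserting it raises the cardinality by
    one.\<close>
  let ?N = "\<lambda>v. {u \<in> A. u \<noteq> v \<and> R u v}"
  obtain v where v: "v \<in> A" and max: "\<And>u. u \<in> A \<Longrightarrow> card (?N u) \<le> card (?N v)"
  proof -
    have "Max ((\<lambda>v. card (?N v)) ` A) \<in> (\<lambda>v. card (?N v)) ` A"
      using assms(1,2) by (intro Max_in) auto
    then obtain v where "v \<in> A" "card (?N v) = Max ((\<lambda>v. card (?N v)) ` A)" by auto
    moreover have "card (?N u) \<le> Max ((\<lambda>v. card (?N v)) ` A)" if "u \<in> A" for u
      using that assms(1) by (intro Max_ge) auto
    ultimately show ?thesis using that by simp
  qed
  have "u = v \<or> R u v \<or> (\<exists>w\<in>A. R u w \<and> R w v)" if u: "u \<in> A" for u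
  proof (rule ccontr)
    assume "\<not> ?thesis"
    then have no: "u \<noteq> v" "\<not> R u v" "\<And>w. w \<in> A \<Longrightarrow> R w v \<Longrightarrow> \<not> R u w" by auto
    have "insert v (?N v) \<subseteq> ?N u"
      using semi u v no by blast
    then have "card (insert v (?N v)) \<le> card (?N u)"
      using \<open>finite A\<close> by (intro card_mono) auto
    moreover have "card (insert v (?N v)) = Suc (card (?N v))"
      using \<open>finite A\<close> by simp
    ultimately show False using max[OF u] by simp
  qed
  with v show ?thesis by blast
qed

text \<open>The alternative \<open>Q \<subseteq> I \<or> (\<exists>v\<in>K. Q = {v})\<close> stands
  for independence: in \<open>D\<close> there are no arcs inside \<open>I\<close> and no
  loops.\<close>

lemma reach2_dominating_set:
  fixes R :: "'a \<Rightarrow> 'a \<Rightarrow> bool"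
  assumes fin: "finite K" "finite I"
    and KK: "\<And>x y. x \<in> K \<Longrightarrow> y \<in> K \<Longrightarrow> x \<noteq> y \<Longrightarrow> R x y \<or> R y x"
    and IK: "\<And>x y. x \<in> I \<Longrightarrow> y \<in> K \<Longrightarrow> R x y \<or> R y x"
    and IO: "\<And>x y. x \<in> I \<Longrightarrow> R x y \<Longrightarrow> y \<in> K"
    and out: "\<And>x. x \<in> I \<Longrightarrow> \<exists>y. R x y"
  shows "\<exists>Q. card Q \<le> 2 \<and> (Q \<subseteq> I \<or> (\<exists>v\<in>K. Q = {v})) \<and> (\<forall>x \<in> K \<union> I. \<exists>q\<in>Q. reach2 R x q)"
proof (cases "K = {}")
  case True
  then have "I = {}" using IO out by blast
  then show ?thesis using True by (intro exI[of _ "{}"]) auto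
next
  case False
  have "\<exists>v\<in>K. \<forall>u\<in>K. u = v \<or> R u v \<or> (\<exists>w\<in>K. R u w \<and> R w v)"
    by (rule semicomplete_reach2[OF fin(1) False KK])
  then obtain v where v: "v \<in> K"
    and vK: "\<And>u. u \<in> K \<Longrightarrow> u = v \<or> R u v \<or> (\<exists>w\<in>K. R u w \<and> R w v)"
    by blast
  define B where "B = {i \<in> I. \<not> reach2 R i v}"
  show ?thesis
  proof (cases "B = {}")
    case True
    have "reach2 R x v" if "x \<in> K \<union> I" for x
      using that vK[of x] True by (auto simp: B_def reach2_def)
    then show ?thesis using v by (intro exI[of _ "{v}"]) auto
  next
    case False
    define N where "N x = {y \<in> K. R x y}" for x
    have finN: "finite (N x)" for x using fin by (simp add: N_def)
    have "finite B" using fin by (simp add: B_def)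
    then obtain u where uB: "u \<in> B" and min: "\<And>i. i \<in> B \<Longrightarrow> card (N u) \<le> card (N i)"
      using False arg_min_if_finite[of B "\<lambda>i. card (N i)"]
      by (metis (no_types, lifting) leI)
    have u: "u \<in> I" using uB by (simp add: B_def)
    have outside: "R k u" if "k \<in> K" "k \<notin> N u" for k
      using IK[OF u] that by (auto simp: N_def)
    \<comment> \<open>An arc from \<open>u\<close> to \<open>v\<close>, or to an inneighbour of
      \<open>v\<close>, would let \<open>u\<close> reach \<open>v\<close> in two steps, against
      \<open>u \<in> B\<close>.\<close>
    have vu: "R v u" and into_v: "\<And>k. k \<in> K \<Longrightarrow> R k v \<Longrightarrow> R k u"
      using v uB by (auto intro!: outside simp: N_def B_def reach2_def)
    have K_u: "reach2 R x u" if "x \<in> K" for x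
      using vK[OF that] vu into_v that by (auto simp: reach2_def)
    \<comment> \<open>For \<open>x\<close> in \<open>B\<close>, if no vertex of \<open>N x\<close>
      dominates \<open>u\<close>, then \<open>N x \<subseteq> N u\<close>, and the minimality of
      \<open>card (N u)\<close> gives equality. Any other \<open>x\<close> reaches \<open>v\<close>
      directly or through an inneighbour of \<open>v\<close>, and all of these dominate
      \<open>u\<close>.\<close>
    have I_u: "reach2 R x u \<or> N x = N u" if "x \<in> I" for x
    proof (cases "x \<in> B")
      case True
      show ?thesis
      proof (cases "\<exists>y\<in>N x. R y u")
        case True
        then show ?thesis by (auto simp: N_def reach2_def)
      next
        case False
        then have "N x \<subseteq> N u" using outside by (auto simp: N_def)
        then have "N x = N u" using min[OF True] finN by (simp add: card_seteq)
        then show ?thesis by simp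
      qed
    next
      case False
      then have "R x v \<or> (\<exists>w\<in>K. R x w \<and> R w v) \<or> x = v"
        using that IO by (auto simp: B_def reach2_def)
      then show ?thesis
        using vu into_v by (auto simp: reach2_def)
    qed
    obtain a\<^sub>0 where a\<^sub>0: "a\<^sub>0 \<in> N u" using out[OF u] IO[OF u] by (auto simp: N_def)
    show ?thesis
    proof (cases "\<exists>a\<in>N u. \<exists>j\<in>I. R a j")
      case True
      then obtain a j where a: "a \<in> N u" and j: "j \<in> I" "R a j" by blast
      \<comment> \<open>A vertex \<open>x\<close> that does not reach \<open>u\<close> has
        \<open>N x = N u\<close>, so it reaches \<open>j\<close> through \<open>a\<close>.\<close>
      have "\<exists>q\<in>{u, j}. reach2 R x q" if x: "x \<in> K \<union> I" for x
      proof (cases "reach2 R x u")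
        case False
        then have "N x = N u" using x K_u I_u by blast
        then have "R x a" using a by (auto simp: N_def)
        then show ?thesis using j by (auto simp: reach2_def)
      qed simp
      moreover have "card {u, j} \<le> 2" by (simp add: card_insert_if)
      ultimately show ?thesis using u j by (intro exI[of _ "{u, j}"]) blast
    next
      case False
      have "N u \<noteq> {}" using a\<^sub>0 by blast
      moreover have "R x y \<or> R y x" if "x \<in> N u" "y \<in> N u" "x \<noteq> y" for x y
        using that KK by (simp add: N_def)
      ultimately have "\<exists>w\<in>N u. \<forall>x\<in>N u. x = w \<or> R x w \<or> (\<exists>y\<in>N u. R x y \<and> R y w)"
        by (rule semicomplete_reach2[OF finN])
      then obtain w where w: "w \<in> N u"
        and wN: "\<And>x. x \<in> N u \<Longrightarrow> x = w \<or> R x w \<or> (\<exists>y\<in>N u. R x y \<and> R y w)"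
        by blast
      have uw: "R u w" and wK: "w \<in> K" using w by (auto simp: N_def)
      have "reach2 R x w" if x: "x \<in> K \<union> I" for x
      proof -
        consider "x \<in> N u" | "x \<in> K" "x \<notin> N u" | "x \<in> I" using x by blast
        then show ?thesis
        proof cases
          case 1
          then show ?thesis using wN[of x] by (auto simp: reach2_def)
        next
          case 2
          then show ?thesis using outside uw by (blast intro: reach2_two_steps)
        next
          case 3
          then show ?thesis using IK[OF 3 wK] False w by (blast intro: reach2_step)
        qed
      qed
      then show ?thesis using wK by (intro exI[of _ "{w}"]) auto
    qed
  qed
qed

lemma (in digraph) apath_le_2_iff_reach2:
  assumes "u \<in> verts G"
  shows "(\<exists>p. apath u p v \<and> length p \<le> 2) \<longleftrightarrow> reach2 (\<lambda>x y. x \<rightarrow>\<^bsub>G\<^esub> y) u v"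
proof
  assume "\<exists>p. apath u p v \<and> length p \<le> 2"
  then obtain p where p: "awalk u p v" "length p \<le> 2" by (auto simp: apath_def)
  consider "p = []" | e where "p = [e]" | e f where "p = [e, f]"
    using p(2) by (cases p; cases "tl p") auto
  then show "reach2 (\<lambda>x y. x \<rightarrow>\<^bsub>G\<^esub> y) u v"
  proof cases
    case 1
    then show ?thesis using p(1) by (simp add: awalk_simps)
  next
    case 2
    then have "e \<in> arcs G" "tail G e = u" "head G e = v"
      using p(1) by (auto simp: awalk_simps)
    then show ?thesis using in_arcs_imp_in_arcs_ends[of e] by (simp add: reach2_step)
  next
    case 3
    then have "e \<in> arcs G" "tail G e = u" "f \<in> arcs G" "tail G f = head G e" "head G f = v"
      using p(1) by (auto simp: awalk_simps)
    then show ?thesis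
      using in_arcs_imp_in_arcs_ends[of e] in_arcs_imp_in_arcs_ends[of f]
      by (simp add: reach2_two_steps)
  qed
next
  assume r: "reach2 (\<lambda>x y. x \<rightarrow>\<^bsub>G\<^esub> y) u v"
  have step: "\<exists>e. e \<in> arcs G \<and> tail G e = x \<and> head G e = y" if "x \<rightarrow>\<^bsub>G\<^esub> y" for x y
    using that by (auto simp: arcs_ends_def arc_to_ends_def)
  have neq: "x \<noteq> y" if "x \<rightarrow>\<^bsub>G\<^esub> y" for x y
    using that adj_not_same by blast
  \<comment> \<open>A walk of two arcs is a path only if its ends differ, hence
    \<open>u \<noteq> v\<close> in the third case; for \<open>u = v\<close> the empty path
    serves.\<close>
  consider "u = v" | "u \<rightarrow>\<^bsub>G\<^esub> v" | w where "u \<noteq> v" "u \<rightarrow>\<^bsub>G\<^esub> w" "w \<rightarrow>\<^bsub>G\<^esub> v"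
    using r by (auto simp: reach2_def)
  then show "\<exists>p. apath u p v \<and> length p \<le> 2"
  proof cases
    case 1
    then show ?thesis using assms by (intro exI[of _ "[]"]) (simp add: apath_Nil_iff)
  next
    case 2
    then obtain e where "e \<in> arcs G" "tail G e = u" "head G e = v" using step by blast
    then show ?thesis using neq[OF 2]
      by (intro exI[of _ "[e]"]) (auto simp: apath_def awalk_simps)
  next
    case 3
    then obtain e f where "e \<in> arcs G" "tail G e = u" "head G e = w"
      "f \<in> arcs G" "tail G f = w" "head G f = v" using step by metis
    then show ?thesis using neq[OF 3(2)] neq[OF 3(3)] 3(1)
      by (intro exI[of _ "[e, f]"]) (auto simp: apath_def awalk_simps)
  qed
qed

lemma quasi_kernel_iff_reach2:
  assumes "digraph D"
  shows "quasi_kernel D Q \<longleftrightarrow>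
    independent_in D Q \<and> (\<forall>x\<in>verts D. \<exists>q\<in>Q. reach2 (\<lambda>x y. x \<rightarrow>\<^bsub>D\<^esub> y) x q)"
  using digraph.apath_le_2_iff_reach2[OF assms] by (simp add: quasi_kernel_def)

lemma sinks_subset_quasi_kernel:
  assumes "digraph D" "quasi_kernel D Q"
  shows "sinks D \<subseteq> Q"
proof
  fix s assume s: "s \<in> sinks D"
  then obtain q where "q \<in> Q" "reach2 (\<lambda>x y. x \<rightarrow>\<^bsub>D\<^esub> y) s q"
    using assms by (auto simp: quasi_kernel_iff_reach2 sinks_def)
  with s show "s \<in> Q" by (auto simp: reach2_def sinks_def)
qed

lemma ex_minimum_quasi_kernel:
  assumes "quasi_kernel D Q"
  obtains Q' where "minimum_quasi_kernel D Q'" "card Q' \<le> card Q"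
  using ex_has_least_nat[of "quasi_kernel D" Q card] assms
  unfolding minimum_quasi_kernel_def by blast

text \<open>Every quasi-kernel is a finite set containing all sinks, so one with no more elements
  than \<open>sinks D\<close> is equal to it.\<close>

lemma quasi_kernel_sinks_minimum:
  assumes "digraph D" "quasi_kernel D (sinks D)"
  shows "minimum_quasi_kernel D Q \<longleftrightarrow> Q = sinks D"
proof -
  interpret digraph D by fact
  have finQ: "finite Q" if "quasi_kernel D Q" for Q
    using that finite_subset[OF _ finite_verts]
    by (auto simp: quasi_kernel_def independent_in_def)
  show ?thesis
    using assms sinks_subset_quasi_kernel[OF assms(1)] card_mono[OF finQ] card_seteq[OF finQ]
    unfolding minimum_quasi_kernel_def by metis
qed

theorem theorem1p2:
  fixes D :: "('a,'b) pre_digraph" and G :: "('a,'c) pre_digraph"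
  assumes "complete_split_graph G" and "biorientation D G"
  shows "(sinks D \<noteq> {} \<longrightarrow>
           (\<exists>!Q. minimum_quasi_kernel D Q) \<and> minimum_quasi_kernel D (sinks D)) \<and>
         (sink_free D \<longrightarrow> (\<exists>Q. minimum_quasi_kernel D Q \<and> card Q \<le> 2))"
proof -
  let ?R = "\<lambda>x y. x \<rightarrow>\<^bsub>D\<^esub> y"
  have dD: "digraph D" and V: "verts D = verts G"
    and adj: "\<And>u v. u \<rightarrow>\<^bsub>G\<^esub> v \<longleftrightarrow> ?R u v \<or> ?R v u"
    using assms(2) by (auto simp: biorientation_def)
  interpret D: digraph D by fact
  obtain K I where KI: "verts G = K \<union> I" "clique_in G K" "independent_in G I"
    and IKG: "\<forall>v\<in>I. \<forall>u\<in>K. v \<rightarrow>\<^bsub>G\<^esub> u"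
    using assms(1) unfolding complete_split_graph_def by blast
  have KK: "?R x y \<or> ?R y x" if "x \<in> K" "y \<in> K" "x \<noteq> y" for x y
    using KI(2) that adj by (auto simp: clique_in_def)
  have IK: "?R x y \<or> ?R y x" if "x \<in> I" "y \<in> K" for x y
    using IKG that adj by blast
  have II: "\<not> ?R x y" if "x \<in> I" "y \<in> I" for x y
    using KI(3) that adj by (auto simp: independent_in_def)
  have IO: "y \<in> K" if "x \<in> I" "?R x y" for x y
    using II[OF that(1)] that(2) D.adj_in_verts(2)[OF that(2)] V KI(1) by blast
  have fin: "finite K" "finite I"
    using D.finite_verts V KI(1) by auto
  have sinks_qk: "quasi_kernel D (sinks D)" if ne: "sinks D \<noteq> {}"
  proof -
    obtain s where s: "s \<in> sinks D" using ne by blast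
    have no: "\<not> ?R t y" if "t \<in> sinks D" for t y using that by (auto simp: sinks_def)
    have "\<exists>q\<in>sinks D. reach2 ?R x q" if x: "x \<in> verts D" for x
    proof (cases "x \<in> sinks D")
      case False
      then obtain y where y: "?R x y" using x by (auto simp: sinks_def)
      have xs: "x \<noteq> s" using False s by blast
      have sV: "s \<in> K \<union> I" using s V KI(1) by (auto simp: sinks_def)
      \<comment> \<open>No arc leaves \<open>s\<close>, so its adjacency to \<open>k\<close> must
        come from an arc into \<open>s\<close>. A vertex of \<open>I\<close> that is not a sink has
        an outneighbour \<open>y\<close> in \<open>K\<close>, and \<open>y\<close> is
        \<open>s\<close> or dominates \<open>s\<close>; hence every vertex that is not a sink
        reaches this one sink.\<close>
      have K_s: "?R k s" if "k \<in> K" "k \<noteq> s" for k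
        using sV KK[of k s] IK[of s k] that no[OF s] by blast
      have "reach2 ?R x s"
      proof (cases "x \<in> K")
        case True
        then show ?thesis using K_s xs by (blast intro: reach2_step)
      next
        case False
        then have "y \<in> K" using x V KI(1) IO y by blast
        then show ?thesis using K_s[of y] y by (auto simp: reach2_def)
      qed
      then show ?thesis using s by blast
    qed (blast intro: reach2_refl)
    moreover have "independent_in D (sinks D)"
      by (auto simp: independent_in_def sinks_def)
    ultimately show ?thesis by (simp add: quasi_kernel_iff_reach2[OF dD])
  qed
  have "\<exists>Q. minimum_quasi_kernel D Q \<and> card Q \<le> 2" if "sink_free D"
  proof -
    have out: "\<exists>y. ?R x y" if "x \<in> I" for x
      using \<open>sink_free D\<close> that V KI(1) by (auto simp: sink_free_def sinks_def)
    obtain Q where Q: "card Q \<le> 2" "Q \<subseteq> I \<or> (\<exists>v\<in>K. Q = {v})"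
      "\<forall>x \<in> K \<union> I. \<exists>q\<in>Q. reach2 ?R x q"
    proof -
      have "\<exists>Q. card Q \<le> 2 \<and> (Q \<subseteq> I \<or> (\<exists>v\<in>K. Q = {v})) \<and>
          (\<forall>x \<in> K \<union> I. \<exists>q\<in>Q. reach2 ?R x q)"
        by (rule reach2_dominating_set[OF fin]) (fact KK IK IO out)+
      then show ?thesis using that by blast
    qed
    have "independent_in D Q"
      using Q(2) V KI(1) II D.adj_not_same unfolding independent_in_def by blast
    then have "quasi_kernel D Q"
      using Q(3) V KI(1) by (simp add: quasi_kernel_iff_reach2[OF dD])
    then show ?thesis using Q(1) ex_minimum_quasi_kernel by (metis order_trans)
  qed
  then show ?thesis
    using quasi_kernel_sinks_minimum[OF dD sinks_qk] by auto
qed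

end
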